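(* Let $\gamma:\mathbb R\to\mathcal S$ be (a natural parametrization of) an isoparametric curve with bending $\kappa$ and twist $\tau$ such that $D_{\kappa,\tau}>0$. Then $\gamma$ is periodic if and only if the spectral ratio $r(\kappa,\tau)$ is rational.
   Context: $\mathbb C^{2,1}$ is $\mathbb C^3$ with the Hermitian form $\langle \mathbf z,\mathbf w\rangle={}^t\overline{\mathbf z}\,\mathbf h\,\mathbf w$, $\mathbf h=\begin{pmatrix}0&0&i\\0&1&0\\-i&0&0\end{pmatrix}$. $\mathcal N$ is the set of nonzero null vectors and $\mathcal S=\{[\mathbf z]\in\mathbb{CP}^2:\langle\mathbf z,\mathbf z\rangle=0\}$, with contact form $\zeta$ equal to the restriction to $T\mathcal S$ of $-i\langle\mathbf z,d\mathbf z\rangle/({}^t\overline{\mathbf z}\mathbf z)$. A lift of a smooth curve $\gamma:J\to\mathcal S$ ($J$ an interval) is a smooth map $\Gamma:J\to\mathcal N$ with $\gamma=[\Gamma]$. $\gamma$ is transversal if $\zeta(\gamma')\ne0$ everywhere; transversal curves are always assumed positively parametrized, $-i\langle\Gamma,\Gamma'\rangle>0$. $\gamma$ is generic if $\det(\Gamma,\Gamma',\Gamma'')$ is nowhere zero. A Wilczynski lift is a lift with $\det(\Gamma,\Gamma',\Gamma'')=-1$. The parametrization is natural if $i\langle\Gamma,\Gamma'\rangle^{-1}=1$ for a Wilczynski lift $\Gamma$; then the bending and twist are $\kappa=\frac12\langle\Gamma',\Gamma'\rangle$ and $\tau=\mathrm{Im}\langle\Gamma'',\Gamma'\rangle+3\kappa^2$.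 A generic transversal curve is isoparametric if its bending and twist are constant. The Hamiltonian is $\mathrm H_{\kappa,\tau}=i\begin{pmatrix}i\kappa&-i&\tau\\0&-2i\kappa&1\\1&0&i\kappa\end{pmatrix}$, with characteristic polynomial $-t^3+(3\kappa^2-\tau)t+2\kappa^3+2\kappa\tau-1$, of discriminant $D_{\kappa,\tau}=-27+108\kappa(\kappa^2+\tau)-324\kappa^4\tau-72\kappa^2\tau^2-4\tau^3$. If $D_{\kappa,\tau}>0$, $\mathrm H_{\kappa,\tau}$ has three distinct real eigenvalues $e_1<e_2<e_3$ with sum $0$ (so $e_3>0$), and the spectral ratio is $r(\kappa,\tau)=e_1/e_3\in(-2,-1/2)$. *)

theory Defs
  imports "HOL-Analysis.Analysis"
begin

definition hmat :: "complex^3^3" where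
  "hmat = vector [vector [0, 0, \<i>],
                  vector [0, 1, 0],
                  vector [-\<i>, 0, 0]]"

text \<open>Conjugate-linear in the first argument, linear in the second.\<close>

definition herm :: "complex^3 \<Rightarrow> complex^3 \<Rightarrow> complex" where
  "herm z w = (\<Sum>a\<in>UNIV. \<Sum>b\<in>UNIV. cnj (z $ a) * hmat $ a $ b * w $ b)"

definition null_vectors :: "(complex^3) set" where
  "null_vectors = {z. z \<noteq> 0 \<and> herm z z = 0}"

text \<open>A point of the complex projective plane is represented by the complex line
  (one-dimensional subspace) that it is.\<close>

definition proj :: "complex^3 \<Rightarrow> (complex^3) set" where
  "proj z = vec.span {z}"

definition sphere_S :: "(complex^3) set set" where
  "sphere_S = proj ` null_vectors"

text \<open>For an open set \<open>U\<close> this is smoothness (of class \<open>C\<^sup>\<infinity>\<close>) on \<open>U\<close>;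
  \<open>D n\<close> is the \<open>n\<close>-th derivative.\<close>

definition smooth_on :: "real set \<Rightarrow> (real \<Rightarrow> 'a::real_normed_vector) \<Rightarrow> bool" where
  "smooth_on U f \<longleftrightarrow> (\<exists>D :: nat \<Rightarrow> real \<Rightarrow> 'a.
     (\<forall>t\<in>U. D 0 t = f t) \<and>
     (\<forall>n. \<forall>t\<in>U. (D n has_vector_derivative D (Suc n) t) (at t)))"

text \<open>The affine charts of the projective plane: on the lines not contained in \<open>z\<^sub>j = 0\<close>,
  the chart sends a line to its unique vector with \<open>j\<close>-th coordinate \<open>1\<close>, that is, to
  its inhomogeneous coordinates \<open>z\<^sub>a / z\<^sub>j\<close>.\<close>

definition chart_domain :: "3 \<Rightarrow> (complex^3) set set" where
  "chart_domain j = {proj z | z. z $ j \<noteq> 0}"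

definition affine_chart :: "3 \<Rightarrow> (complex^3) set \<Rightarrow> complex^3" where
  "affine_chart j L = (THE w. w \<in> L \<and> w $ j = 1)"

text \<open>All curves are parametrized by the whole real line.\<close>

definition smooth_curve :: "(real \<Rightarrow> (complex^3) set) \<Rightarrow> bool" where
  "smooth_curve \<gamma> \<longleftrightarrow>
     (\<forall>t. \<gamma> t \<in> sphere_S) \<and>
     (\<forall>j. open {t. \<gamma> t \<in> chart_domain j} \<and>
          smooth_on {t. \<gamma> t \<in> chart_domain j} (\<lambda>t. affine_chart j (\<gamma> t)))"

definition is_lift :: "(real \<Rightarrow> (complex^3) set) \<Rightarrow> (real \<Rightarrow> complex^3) \<Rightarrow> bool" where
  "is_lift \<gamma> \<Gamma> \<longleftrightarrow>
     smooth_on UNIV \<Gamma> \<and> (\<forall>t. \<Gamma> t \<in> null_vectors \<and> \<gamma> t = proj (\<Gamma> t))"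

abbreviation deriv1 :: "(real \<Rightarrow> complex^3) \<Rightarrow> real \<Rightarrow> complex^3" where
  "deriv1 \<Gamma> \<equiv> (\<lambda>t. vector_derivative \<Gamma> (at t))"

abbreviation deriv2 :: "(real \<Rightarrow> complex^3) \<Rightarrow> real \<Rightarrow> complex^3" where
  "deriv2 \<Gamma> \<equiv> deriv1 (deriv1 \<Gamma>)"

definition det3 :: "complex^3 \<Rightarrow> complex^3 \<Rightarrow> complex^3 \<Rightarrow> complex" where
  "det3 u v w = det (transpose (vector [u, v, w]))"

text \<open>The contact form at the point \<open>proj z\<close>, evaluated on the image under the differential
  of the projection of the vector \<open>v\<close> at \<open>z\<close>. On vectors tangent to the null cone its value
  is real and depends only on that image.\<close>

definition contact_form :: "complex^3 \<Rightarrow> complex^3 \<Rightarrow> complex" where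
  "contact_form z v = - \<i> * herm z v / (\<Sum>a\<in>UNIV. cnj (z $ a) * z $ a)"

text \<open>The next three conditions do not depend on the choice of the lift. The number
  \<open>- \<i> * herm \<Gamma> \<Gamma>'\<close> is automatically real.\<close>

definition transversal :: "(real \<Rightarrow> (complex^3) set) \<Rightarrow> bool" where
  "transversal \<gamma> \<longleftrightarrow>
     (\<exists>\<Gamma>. is_lift \<gamma> \<Gamma> \<and> (\<forall>t. contact_form (\<Gamma> t) (deriv1 \<Gamma> t) \<noteq> 0))"

definition positively_parametrized :: "(real \<Rightarrow> (complex^3) set) \<Rightarrow> bool" where
  "positively_parametrized \<gamma> \<longleftrightarrow>
     (\<exists>\<Gamma>. is_lift \<gamma> \<Gamma> \<and> (\<forall>t. Re (- \<i> * herm (\<Gamma> t) (deriv1 \<Gamma> t)) > 0))"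

definition generic :: "(real \<Rightarrow> (complex^3) set) \<Rightarrow> bool" where
  "generic \<gamma> \<longleftrightarrow>
     (\<exists>\<Gamma>. is_lift \<gamma> \<Gamma> \<and> (\<forall>t. det3 (\<Gamma> t) (deriv1 \<Gamma> t) (deriv2 \<Gamma> t) \<noteq> 0))"

definition wilczynski_lift :: "(real \<Rightarrow> (complex^3) set) \<Rightarrow> (real \<Rightarrow> complex^3) \<Rightarrow> bool" where
  "wilczynski_lift \<gamma> \<Gamma> \<longleftrightarrow>
     is_lift \<gamma> \<Gamma> \<and> (\<forall>t. det3 (\<Gamma> t) (deriv1 \<Gamma> t) (deriv2 \<Gamma> t) = - 1)"

definition natural_lift :: "(real \<Rightarrow> (complex^3) set) \<Rightarrow> (real \<Rightarrow> complex^3) \<Rightarrow> bool" where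
  "natural_lift \<gamma> \<Gamma> \<longleftrightarrow>
     wilczynski_lift \<gamma> \<Gamma> \<and> (\<forall>t. \<i> * inverse (herm (\<Gamma> t) (deriv1 \<Gamma> t)) = 1)"

text \<open>\<open>herm v v\<close> is real for every \<open>v\<close>, so \<open>Re\<close> discards nothing.\<close>

definition bending :: "(real \<Rightarrow> complex^3) \<Rightarrow> real \<Rightarrow> real" where
  "bending \<Gamma> t = 1/2 * Re (herm (deriv1 \<Gamma> t) (deriv1 \<Gamma> t))"

definition twist :: "(real \<Rightarrow> complex^3) \<Rightarrow> real \<Rightarrow> real" where
  "twist \<Gamma> t = Im (herm (deriv2 \<Gamma> t) (deriv1 \<Gamma> t)) + 3 * (bending \<Gamma> t)^2"

text \<open>A naturally parametrized generic transversal curve with constant bending \<open>\<kappa>\<close> and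
  constant twist \<open>\<tau>\<close>. Two Wilczynski lifts of the same curve differ by a constant cube root
  of unity, so naturality, bending and twist do not depend on the lift.\<close>

definition isoparametric ::
  "(real \<Rightarrow> (complex^3) set) \<Rightarrow> real \<Rightarrow> real \<Rightarrow> bool" where
  "isoparametric \<gamma> \<kappa> \<tau> \<longleftrightarrow>
     smooth_curve \<gamma> \<and> transversal \<gamma> \<and> positively_parametrized \<gamma> \<and> generic \<gamma> \<and>
     (\<exists>\<Gamma>. natural_lift \<gamma> \<Gamma> \<and> (\<forall>t. bending \<Gamma> t = \<kappa> \<and> twist \<Gamma> t = \<tau>))"

definition periodic_curve :: "(real \<Rightarrow> (complex^3) set) \<Rightarrow> bool" where
  "periodic_curve \<gamma> \<longleftrightarrow> (\<exists>T>0. \<forall>t. \<gamma> (t + T) = \<gamma> t)"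

definition hamiltonian :: "real \<Rightarrow> real \<Rightarrow> complex^3^3" where
  "hamiltonian \<kappa> \<tau> = (\<chi> a b. \<i> *
     (vector [vector [\<i> * of_real \<kappa>, - \<i>, of_real \<tau>],
              vector [0, - 2 * \<i> * of_real \<kappa>, 1],
              vector [1, 0, \<i> * of_real \<kappa>]] :: complex^3^3) $ a $ b)"

definition discriminant_D :: "real \<Rightarrow> real \<Rightarrow> real" where
  "discriminant_D \<kappa> \<tau> =
     - 27 + 108 * \<kappa> * (\<kappa>^2 + \<tau>) - 324 * \<kappa>^4 * \<tau> - 72 * \<kappa>^2 * \<tau>^2 - 4 * \<tau>^3"

definition real_eigenvalues :: "complex^3^3 \<Rightarrow> real set" where
  "real_eigenvalues A = {e. \<exists>v. v \<noteq> 0 \<and> A *v v = complex_of_real e *s v}"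

text \<open>If the discriminant is positive, the three eigenvalues \<open>e\<^sub>1 < e\<^sub>2 < e\<^sub>3\<close> of the Hamiltonian
  are real, so that \<open>e\<^sub>1\<close> is the minimum and \<open>e\<^sub>3\<close> the maximum.\<close>

definition spectral_ratio :: "real \<Rightarrow> real \<Rightarrow> real" where
  "spectral_ratio \<kappa> \<tau> =
     Min (real_eigenvalues (hamiltonian \<kappa> \<tau>)) / Max (real_eigenvalues (hamiltonian \<kappa> \<tau>))"

end

theory Submission
  imports Defs
begin

text \<open>For a natural lift \<open>\<Gamma>\<close> with constant invariants the Gram matrix of \<open>\<Gamma>, \<Gamma>', \<Gamma>''\<close> is
  constant: its last entry is forced by \<open>det (\<Gamma>, \<Gamma>', \<Gamma>'') = -1\<close>. Hence
  \<open>\<Gamma>''' = p \<Gamma>' - \<i> q \<Gamma>\<close> with real constants \<open>p\<close>, \<open>q\<close>, and the characteristic roots are \<open>-\<i> e\<close> for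
  the eigenvalues \<open>e\<close> of the Hamiltonian. When these are real and distinct, \<open>\<Gamma>\<close> is a combination of
  the \<open>exp (-\<i> e t)\<close> with linearly independent coefficient vectors. So the line through \<open>\<Gamma> T\<close> is
  the line through \<open>\<Gamma> 0\<close> exactly if the three phases \<open>exp (-\<i> e T)\<close> agree, and since the eigenvalues
  sum to \<open>0\<close> this happens for some \<open>T > 0\<close> exactly if \<open>e\<^sub>1 / e\<^sub>3\<close> is rational.\<close>

section \<open>Coordinates and derivatives of the Hermitian form and the determinant\<close>

lemma herm_components:
  "herm z w = \<i> * (cnj (z $ 1) * w $ 3) + cnj (z $ 2) * w $ 2 - \<i> * (cnj (z $ 3) * w $ 1)"
  unfolding herm_def hmat_def by (simp add: sum_3)

lemma det3_components:
  "det3 u v w =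
     u $ 1 * (v $ 2 * w $ 3 - v $ 3 * w $ 2) - u $ 2 * (v $ 1 * w $ 3 - v $ 3 * w $ 1)
       + u $ 3 * (v $ 1 * w $ 2 - v $ 2 * w $ 1)"
  unfolding det3_def det_transpose by (simp add: det_3 algebra_simps)

lemma cnj_herm: "cnj (herm z w) = herm w z"
  by (simp add: herm_components)

text \<open>Conjugation is only real linear, but the parameter is real, so the product rule survives
  in the conjugated argument.\<close>

lemma has_vector_derivative_herm:
  assumes "(f has_vector_derivative f') (at t)" "(g has_vector_derivative g') (at t)"
  shows "((\<lambda>t. herm (f t) (g t)) has_vector_derivative herm (f t) g' + herm f' (g t)) (at t)"
proof -
  have [derivative_intros]: "((\<lambda>t. f t $ k) has_vector_derivative f' $ k) (at t)"
    "((\<lambda>t. g t $ k) has_vector_derivative g' $ k) (at t)" for k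
    using assms
    by (auto intro: bounded_linear.has_vector_derivative[OF bounded_linear_vec_nth])
  have [derivative_intros]: "((\<lambda>t. cnj (f t $ k)) has_vector_derivative cnj (f' $ k)) (at t)" for k
    by (intro bounded_linear.has_vector_derivative[OF bounded_linear_cnj] derivative_intros)
  show ?thesis
    unfolding herm_components
    by (rule derivative_eq_intros refl | simp add: algebra_simps)+
qed

lemma herm_derivative_constant:
  assumes "\<And>t. (f has_vector_derivative f' t) (at t)" "\<And>t. (g has_vector_derivative g' t) (at t)"
    and "\<And>t. herm (f t) (g t) = c"
  shows "herm (f t) (g' t) + herm (f' t) (g t) = 0"
proof -
  have "((\<lambda>t. c) has_vector_derivative herm (f t) (g' t) + herm (f' t) (g t)) (at t)"
    using has_vector_derivative_herm[OF assms(1,2), of t] assms(3) by simp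
  from vector_derivative_unique_at[OF this has_vector_derivative_const] show ?thesis .
qed

text \<open>Of the three terms of the product rule, two have a repeated column and vanish.\<close>

lemma det3_derivative_constant:
  assumes "\<And>t. (f has_vector_derivative f' t) (at t)" "\<And>t. (f' has_vector_derivative f'' t) (at t)"
    "\<And>t. (f'' has_vector_derivative f''' t) (at t)"
    and "\<And>t. det3 (f t) (f' t) (f'' t) = c"
  shows "det3 (f t) (f' t) (f''' t) = 0"
proof -
  have [derivative_intros]: "((\<lambda>t. f t $ k) has_vector_derivative f' t $ k) (at t)"
    "((\<lambda>t. f' t $ k) has_vector_derivative f'' t $ k) (at t)"
    "((\<lambda>t. f'' t $ k) has_vector_derivative f''' t $ k) (at t)" for k
    using assms
    by (auto intro: bounded_linear.has_vector_derivative[OF bounded_linear_vec_nth])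
  have "((\<lambda>t. det3 (f t) (f' t) (f'' t)) has_vector_derivative det3 (f t) (f' t) (f''' t)) (at t)"
    unfolding det3_components
    by (rule derivative_eq_intros refl | simp add: algebra_simps)+
  then have "((\<lambda>t. c) has_vector_derivative det3 (f t) (f' t) (f''' t)) (at t)"
    using assms(4) by simp
  from vector_derivative_unique_at[OF this has_vector_derivative_const] show ?thesis .
qed

section \<open>Linear algebra in a frame\<close>

text \<open>Cramer's rule, cleared of the denominator and hence valid for degenerate triples as
  well.\<close>

lemma det3_cramer:
  "det3 u v w *s x = det3 x v w *s u + det3 u x w *s v + det3 u v x *s w"
  by (simp add: vec_eq_iff forall_3 det3_components algebra_simps)

lemma det3_independent:
  assumes "det3 u v w \<noteq> 0" "a *s u + b *s v + c *s w = 0"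
  shows "a = 0" "b = 0" "c = 0"
proof -
  have "a * det3 u v w = det3 (a *s u + b *s v + c *s w) v w"
    "b * det3 u v w = det3 u (a *s u + b *s v + c *s w) w"
    "c * det3 u v w = det3 u v (a *s u + b *s v + c *s w)"
    by (simp_all add: det3_components algebra_simps)
  then show "a = 0" "b = 0" "c = 0"
    using assms by (simp_all add: det3_components)
qed

text \<open>The sign is \<open>det hmat = -1\<close>.\<close>

lemma herm_gram:
  "herm u u * (herm v v * herm w w - herm v w * herm w v)
     - herm u v * (herm v u * herm w w - herm v w * herm w u)
     + herm u w * (herm v u * herm w v - herm v v * herm w u)
   = - (det3 u v w * cnj (det3 u v w))"
  unfolding herm_components det3_components complex_cnj_add complex_cnj_diff complex_cnj_mult
  by (simp add: algebra_simps)

lemma herm_linear_right: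
  "herm z (a *s u + b *s v + c *s w) = a * herm z u + b * herm z v + c * herm z w"
  "herm z (u - v) = herm z u - herm z v"
  "herm z (a *s u) = a * herm z u"
  by (simp_all add: herm_components algebra_simps)

lemma det3_linear_third:
  "det3 u v (w - w') = det3 u v w - det3 u v w'" "det3 u v (a *s u) = 0" "det3 u v (a *s v) = 0"
  by (simp_all add: det3_components algebra_simps)

text \<open>Expand \<open>x\<close> in the frame: \<open>det3 u v x = 0\<close> removes the
  \<open>w\<close> component. Since \<open>u\<close> is null, pairing with \<open>u\<close> then
  sees only the \<open>v\<close> component, and pairing with \<open>v\<close> afterwards only the
  \<open>u\<close> component.\<close>

lemma frame_vector_zero:
  assumes "det3 u v w \<noteq> 0" "herm u u = 0" "herm u v \<noteq> 0"
    and "det3 u v x = 0" "herm u x = 0" "herm v x = 0"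
  shows "x = 0"
proof -
  define d where "d = det3 u v w"
  have x: "d *s x = det3 x v w *s u + det3 u x w *s v + 0 *s w"
    using det3_cramer[of u v w x] assms(4) by (simp add: d_def)
  have "herm u (d *s x) = det3 u x w * herm u v"
    unfolding x herm_linear_right using assms(2) by simp
  with assms have y: "det3 u x w = 0"
    by (simp add: herm_linear_right)
  have "herm v (d *s x) = det3 x v w * herm v u"
    unfolding x herm_linear_right using y by simp
  moreover have "herm v u \<noteq> 0"
    using assms(3) cnj_herm[of v u] by auto
  ultimately have "det3 x v w = 0"
    using assms by (simp add: herm_linear_right)
  with x y have "d *s x = 0" by simp
  with assms(1) show ?thesis
    by (simp add: d_def)
qed

section \<open>The differential equation of the lift\<close>

text \<open>Differentiating the constant Gram entries gives the products of the third derivative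
  with \<open>\<Gamma>\<close> and \<open>\<Gamma>1\<close>. Together with the constant determinant
  they determine it by \<open>frame_vector_zero\<close>.\<close>

lemma isoparametric_ode:
  fixes \<Gamma> \<Gamma>1 \<Gamma>2 \<Gamma>3 :: "real \<Rightarrow> complex^3"
  assumes d0: "\<And>t. (\<Gamma> has_vector_derivative \<Gamma>1 t) (at t)"
    and d1: "\<And>t. (\<Gamma>1 has_vector_derivative \<Gamma>2 t) (at t)"
    and d2: "\<And>t. (\<Gamma>2 has_vector_derivative \<Gamma>3 t) (at t)"
    and null: "\<And>t. herm (\<Gamma> t) (\<Gamma> t) = 0"
    and natural: "\<And>t. herm (\<Gamma> t) (\<Gamma>1 t) = \<i>"
    and det: "\<And>t. det3 (\<Gamma> t) (\<Gamma>1 t) (\<Gamma>2 t) = -1"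
    and bending: "\<And>t. Re (herm (\<Gamma>1 t) (\<Gamma>1 t)) = 2 * \<kappa>"
    and twist: "\<And>t. Im (herm (\<Gamma>2 t) (\<Gamma>1 t)) = \<tau> - 3 * \<kappa>\<^sup>2"
  shows "\<Gamma>3 t = of_real (\<tau> - 3 * \<kappa>\<^sup>2) *s \<Gamma>1 t
           + (- \<i> * of_real (1 - 2 * \<kappa> * \<tau> - 2 * \<kappa> ^ 3)) *s \<Gamma> t"
proof -
  define \<mu> where "\<mu> = \<tau> - 3 * \<kappa>\<^sup>2"
  define \<rho> where "\<rho> = 1 - 4 * \<kappa> * \<mu> - 8 * \<kappa> ^ 3"
  have real: "Im (herm z z) = 0" for z
    using cnj_herm[of z z] by (simp add: complex_eq_iff)
  have h11: "herm (\<Gamma>1 t) (\<Gamma>1 t) = of_real (2 * \<kappa>)" for t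
    using bending[of t] real[of "\<Gamma>1 t"] by (simp add: complex_eq_iff)
  have h10: "herm (\<Gamma>1 t) (\<Gamma> t) = - \<i>" for t
    using cnj_herm[of "\<Gamma> t" "\<Gamma>1 t"] natural[of t] by simp
  have h02: "herm (\<Gamma> t) (\<Gamma>2 t) = - of_real (2 * \<kappa>)" for t
    using herm_derivative_constant[OF d0 d1 natural, of t] h11[of t]
    by (simp add: add_eq_0_iff2)
  have h20: "herm (\<Gamma>2 t) (\<Gamma> t) = - of_real (2 * \<kappa>)" for t
    using cnj_herm[of "\<Gamma> t" "\<Gamma>2 t"] h02[of t] by simp
  have "Re (herm (\<Gamma>2 t) (\<Gamma>1 t)) = 0" for t
    using herm_derivative_constant[OF d1 d1 h11, of t] cnj_herm[of "\<Gamma>2 t" "\<Gamma>1 t"]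
    by (simp add: complex_eq_iff)
  then have h21: "herm (\<Gamma>2 t) (\<Gamma>1 t) = \<i> * of_real \<mu>" for t
    using twist[of t] by (simp add: complex_eq_iff \<mu>_def)
  have h12: "herm (\<Gamma>1 t) (\<Gamma>2 t) = - \<i> * of_real \<mu>" for t
    using cnj_herm[of "\<Gamma>2 t" "\<Gamma>1 t"] h21[of t] by simp
  \<comment> \<open>In the Gram identity this is the only unknown entry; its coefficient is minus
    the squared modulus of \<open>herm (\<Gamma> t) (\<Gamma>1 t)\<close>, that is
    \<open>-1\<close>.\<close>
  have h22: "herm (\<Gamma>2 t) (\<Gamma>2 t) = of_real \<rho>" for t
    using herm_gram[of "\<Gamma> t" "\<Gamma>1 t" "\<Gamma>2 t"] real[of "\<Gamma>2 t"]
    by (simp add: null natural det h10 h11 h02 h20 h12 h21 \<rho>_def complex_eq_iff algebra_simps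
        power3_eq_cube)
  have h03: "herm (\<Gamma> t) (\<Gamma>3 t) = \<i> * of_real \<mu>"
    using herm_derivative_constant[OF d0 d2 h02, of t] h12[of t] by (simp add: add_eq_0_iff2)
  have h13: "herm (\<Gamma>1 t) (\<Gamma>3 t) = - of_real \<rho>"
    using herm_derivative_constant[OF d1 d2 h12, of t] h22[of t] by (simp add: add_eq_0_iff2)
  define a where "a = - \<i> * of_real (1 - 2 * \<kappa> * \<tau> - 2 * \<kappa> ^ 3)"
  have "\<Gamma>3 t - of_real \<mu> *s \<Gamma>1 t - a *s \<Gamma> t = 0"
  proof (rule frame_vector_zero[of "\<Gamma> t" "\<Gamma>1 t" "\<Gamma>2 t"])
    show "herm (\<Gamma>1 t) (\<Gamma>3 t - of_real \<mu> *s \<Gamma>1 t - a *s \<Gamma> t) = 0"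
      unfolding herm_linear_right h13 h11 h10 a_def \<rho>_def \<mu>_def
      by (simp add: complex_eq_iff algebra_simps power2_eq_square power3_eq_cube)
  qed (simp_all add: det null natural herm_linear_right det3_linear_third h03
        det3_derivative_constant[OF d0 d1 d2 det])
  then show ?thesis
    by (simp add: \<mu>_def a_def algebra_simps)
qed

section \<open>Solving the scalar equation\<close>

lemma exponential_ode:
  fixes y :: "real \<Rightarrow> complex"
  assumes "\<And>t. (y has_vector_derivative l * y t) (at t)"
  shows "y t = exp (l * of_real t) * y 0"
proof -
  define g where "g t = exp (- l * of_real t) * y t" for t
  have "(g has_vector_derivative 0) (at t)" for t
    unfolding g_def
    by (rule derivative_eq_intros has_vector_derivative_real_field assms refl
        | simp add: algebra_simps)+
  then have "g t = g 0"
    using has_vector_derivative_zero_constant[of UNIV g] by fastforce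
  then show ?thesis
    by (simp add: g_def exp_minus field_simps)
qed

text \<open>The three quadratic factors \<open>(X\<^sup>3 - m X - a) / (X - l\<^sub>j)\<close>, applied to \<open>d/dt\<close>, turn a solution
  into multiples of \<open>exp (l\<^sub>j t)\<close>; Lagrange interpolation recovers the solution from them.\<close>

lemma cubic_ode_solution:
  fixes y y1 y2 :: "real \<Rightarrow> complex"
  assumes d0: "\<And>t. (y has_vector_derivative y1 t) (at t)"
    and d1: "\<And>t. (y1 has_vector_derivative y2 t) (at t)"
    and d2: "\<And>t. (y2 has_vector_derivative m * y1 t + a * y t) (at t)"
    and roots: "l1 ^ 3 = m * l1 + a" "l2 ^ 3 = m * l2 + a" "l3 ^ 3 = m * l3 + a"
  shows "(l1 - l2) * (l1 - l3) * (l2 - l3) * y t =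
      (l2 - l3) * exp (l1 * of_real t) * (y2 0 + l1 * y1 0 + (l1\<^sup>2 - m) * y 0)
    + (l3 - l1) * exp (l2 * of_real t) * (y2 0 + l2 * y1 0 + (l2\<^sup>2 - m) * y 0)
    + (l1 - l2) * exp (l3 * of_real t) * (y2 0 + l3 * y1 0 + (l3\<^sup>2 - m) * y 0)"
proof -
  define u where "u l t = y2 t + l * y1 t + (l\<^sup>2 - m) * y t" for l t
  have u: "u l t = exp (l * of_real t) * u l 0" if l: "l ^ 3 = m * l + a" for l t
  proof (rule exponential_ode)
    fix t
    have a: "a = l ^ 3 - m * l" using l by simp
    show "(u l has_vector_derivative l * u l t) (at t)"
      unfolding u_def
      by (rule derivative_eq_intros d0 d1 d2 refl
          | simp add: algebra_simps a power2_eq_square power3_eq_cube)+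
  qed
  \<comment> \<open>The cyclic weights sum to zero, also after multiplication by the
    \<open>l\<close>s, so \<open>y2\<close>, \<open>y1\<close> and the \<open>m\<close> terms
    cancel; the squares leave the Vandermonde product.\<close>
  have "(l1 - l2) * (l1 - l3) * (l2 - l3) * y t =
      (l2 - l3) * u l1 t + (l3 - l1) * u l2 t + (l1 - l2) * u l3 t"
    by (simp add: u_def algebra_simps power2_eq_square)
  then show ?thesis
    unfolding u[OF roots(1), of t] u[OF roots(2), of t] u[OF roots(3), of t]
    unfolding u_def by (simp add: mult.assoc)
qed

section \<open>The spectrum of the Hamiltonian\<close>

text \<open>The cubic is the characteristic polynomial up to sign. The third and first rows express
  \<open>v $ 1\<close> and \<open>v $ 2\<close> through \<open>v $ 3\<close>, which is therefore
  nonzero in an eigenvector; the second row then becomes the cubic.\<close>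

lemma real_eigenvalues_hamiltonian:
  "real_eigenvalues (hamiltonian \<kappa> \<tau>)
     = {e. e ^ 3 + (\<tau> - 3 * \<kappa>\<^sup>2) * e + (1 - 2 * \<kappa> * \<tau> - 2 * \<kappa> ^ 3) = 0}"
    (is "_ = {e. ?p e = 0}")
proof (intro equalityI subsetI CollectI)
  have comp: "hamiltonian \<kappa> \<tau> *v v = complex_of_real e *s v \<longleftrightarrow>
      - of_real \<kappa> * v $ 1 + v $ 2 + \<i> * of_real \<tau> * v $ 3 = of_real e * v $ 1 \<and>
      2 * of_real \<kappa> * v $ 2 + \<i> * v $ 3 = e * v $ 2 \<and>
      \<i> * v $ 1 - \<kappa> * v $ 3 = e * v $ 3" for e :: real and v
    by (simp add: vec_eq_iff forall_3 matrix_vector_mult_def sum_3 hamiltonian_def algebra_simps)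
  have i: "\<i> * \<i> = -1" by simp
  {
    fix e assume "e \<in> real_eigenvalues (hamiltonian \<kappa> \<tau>)"
    then obtain v where v: "v \<noteq> 0" "hamiltonian \<kappa> \<tau> *v v = complex_of_real e *s v"
      unfolding real_eigenvalues_def by blast
    have v1: "v $ 1 = - \<i> * (of_real e + of_real \<kappa>) * v $ 3"
      using v(2)[unfolded comp] i by algebra
    have v2: "v $ 2 = - \<i> * ((of_real e + of_real \<kappa>)\<^sup>2 + of_real \<tau>) * v $ 3"
      using v(2)[unfolded comp] v1 i by algebra
    have "of_real (?p e) * v $ 3 = 0"
      using v(2)[unfolded comp] v1 v2 i
      unfolding of_real_add of_real_mult of_real_power of_real_diff of_real_numeral of_real_1
      by algebra
    moreover have "v $ 3 \<noteq> 0"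
      using v(1) v1 v2 by (auto simp: vec_eq_iff forall_3)
    ultimately show "?p e = 0"
      by (metis mult_eq_0_iff of_real_eq_0_iff)
  }
  fix e assume "e \<in> {e. ?p e = 0}"
  then have "of_real (?p e) = (0 :: complex)" by simp
  then have p: "complex_of_real e ^ 3 + (of_real \<tau> - 3 * of_real \<kappa> ^ 2) * of_real e
      + (1 - 2 * of_real \<kappa> * of_real \<tau> - 2 * of_real \<kappa> ^ 3) = 0"
    by simp
  define v :: "complex^3" where
    "v = vector [- \<i> * (of_real e + of_real \<kappa>),
      - \<i> * ((of_real e + of_real \<kappa>)\<^sup>2 + of_real \<tau>), 1]"
  have "hamiltonian \<kappa> \<tau> *v v = complex_of_real e *s v"
    unfolding comp v_def vector_3
  proof (intro conjI)
    show "2 * complex_of_real \<kappa> * (- \<i> * ((of_real e + of_real \<kappa>)\<^sup>2 + of_real \<tau>)) + \<i> * 1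
        = of_real e * (- \<i> * ((of_real e + of_real \<kappa>)\<^sup>2 + of_real \<tau>))"
      using p by algebra
  qed (simp_all add: algebra_simps power2_eq_square)
  moreover have "v \<noteq> 0"
    by (auto simp: v_def vec_eq_iff forall_3)
  ultimately show "e \<in> real_eigenvalues (hamiltonian \<kappa> \<tau>)"
    unfolding real_eigenvalues_def by blast
qed

text \<open>The hypothesis is positivity of the discriminant. It makes the critical values at
  \<open>- m\<close> and \<open>m\<close> have opposite signs, so the intermediate value theorem
  yields three roots.\<close>

lemma depressed_cubic_roots:
  fixes p q :: real
  assumes "- 4 * p ^ 3 - 27 * q\<^sup>2 > 0"
  obtains x y z where "x < y" "y < z" "x + y + z = 0"
    "{t. t ^ 3 + p * t + q = 0} = {x, y, z}"
proof -
  define f where "f t = t ^ 3 + p * t + q" for t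
  have "p ^ 3 < 0"
    using assms zero_le_power2[of q] by linarith
  then have p: "p < 0"
    by (simp add: power_less_zero_eq)
  define m where "m = sqrt (- p / 3)"
  have m: "m > 0" "p = - 3 * m\<^sup>2"
    using p by (simp_all add: m_def)
  have "q\<^sup>2 < (2 * m ^ 3)\<^sup>2"
    using assms unfolding m(2) by (simp add: power_mult_distrib flip: power_mult)
  then have q: "\<bar>q\<bar> < 2 * m ^ 3"
    using m(1) power2_less_imp_less[of "\<bar>q\<bar>" "2 * m ^ 3"] by simp
  have cont: "continuous_on A f" for A
    unfolding f_def by (intro continuous_intros)
  \<comment> \<open>Here \<open>f (- 2 * m) = f m = q - 2 * m ^ 3\<close> and
    \<open>f (2 * m) = f (- m) = q + 2 * m ^ 3\<close>.\<close>
  have signs: "f (- 2 * m) < 0" "f (- m) > 0" "f m < 0" "f (2 * m) > 0"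
    using q unfolding f_def m(2) by (auto simp: power2_eq_square power3_eq_cube)
  obtain x where x: "- 2 * m \<le> x" "x \<le> - m" "f x = 0"
    using IVT'[of f "- 2 * m" 0 "- m"] signs m cont by fastforce
  obtain y where y: "- m \<le> y" "y \<le> m" "f y = 0"
    using IVT2'[of f m 0 "- m"] signs m cont by fastforce
  obtain z where z: "m \<le> z" "z \<le> 2 * m" "f z = 0"
    using IVT'[of f m 0 "2 * m"] signs m cont by fastforce
  have ne: "x \<noteq> - m" "y \<noteq> - m" "y \<noteq> m" "z \<noteq> m"
    using signs x y z by auto
  have xy: "x < y" and yz: "y < z"
    using ne x y z by auto
  \<comment> \<open>Cancelling the root differences leaves two quadratic relations, whose difference
    factors as \<open>(x - z) * (x + y + z)\<close>.\<close>
  have "(x - y) * (x\<^sup>2 + x * y + y\<^sup>2 + p) = f x - f y"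
    "(y - z) * (y\<^sup>2 + y * z + z\<^sup>2 + p) = f y - f z"
    by (simp_all add: f_def algebra_simps power2_eq_square power3_eq_cube)
  then have v1: "x\<^sup>2 + x * y + y\<^sup>2 + p = 0" and v2: "y\<^sup>2 + y * z + z\<^sup>2 + p = 0"
    using x y z xy yz by auto
  then have "(x - z) * (x + y + z) = 0"
    by algebra
  then have s: "x + y + z = 0"
    using xy yz by simp
  have "f t = (t - x) * (t - y) * (t - z)" for t
    using s v1 x(3) unfolding f_def by algebra
  then have "{t. f t = 0} = {x, y, z}"
    by auto
  with that[OF xy yz s] show ?thesis
    unfolding f_def .
qed

section \<open>From the projective curve to its lift\<close>

lemma proj_eq_imp_multiple:
  assumes "proj v = proj w"
  obtains c where "v = c *s w"
proof -
  have "v \<in> vec.span {w}"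
    using assms vec.span_base[of v "{v}"] by (simp add: proj_def)
  then show ?thesis
    using that by (auto simp: vec.span_singleton)
qed

text \<open>Replaces \<open>vector_derivative\<close> by explicit derivative functions, taken from
  the smoothness witness \<open>D\<close>, so that the curve becomes a linear system.\<close>

lemma isoparametric_frame:
  assumes "isoparametric \<gamma> \<kappa> \<tau>"
  shows "\<exists>\<Gamma> \<Gamma>1 \<Gamma>2. \<forall>t. \<gamma> t = proj (\<Gamma> t)
    \<and> (\<Gamma> has_vector_derivative \<Gamma>1 t) (at t)
    \<and> (\<Gamma>1 has_vector_derivative \<Gamma>2 t) (at t)
    \<and> (\<Gamma>2 has_vector_derivative of_real (\<tau> - 3 * \<kappa>\<^sup>2) *s \<Gamma>1 t
         + (- \<i> * of_real (1 - 2 * \<kappa> * \<tau> - 2 * \<kappa> ^ 3)) *s \<Gamma> t) (at t)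
    \<and> det3 (\<Gamma> t) (\<Gamma>1 t) (\<Gamma>2 t) = -1"
proof -
  obtain \<Gamma> where \<Gamma>: "natural_lift \<gamma> \<Gamma>" "\<And>t. bending \<Gamma> t = \<kappa>" "\<And>t. twist \<Gamma> t = \<tau>"
    using assms unfolding isoparametric_def by blast
  have lift: "is_lift \<gamma> \<Gamma>"
    and det: "\<And>t. det3 (\<Gamma> t) (deriv1 \<Gamma> t) (deriv2 \<Gamma> t) = - 1"
    and nat: "\<And>t. \<i> * inverse (herm (\<Gamma> t) (deriv1 \<Gamma> t)) = 1"
    using \<Gamma>(1) unfolding natural_lift_def wilczynski_lift_def by auto
  obtain D where D0: "\<And>t. D 0 t = \<Gamma> t"
    and D: "\<And>n t. (D n has_vector_derivative D (Suc n) t) (at t)"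
    using lift unfolding is_lift_def smooth_on_def by auto
  have "D 0 = \<Gamma>" using D0 by auto
  then have d0: "(\<Gamma> has_vector_derivative D 1 t) (at t)" for t
    using D[of 0] by simp
  have d1: "(D 1 has_vector_derivative D 2 t) (at t)" for t
    using D[of 1] by (simp add: numeral_2_eq_2)
  have d2: "(D 2 has_vector_derivative D 3 t) (at t)" for t
    using D[of 2] by (simp add: numeral_3_eq_3 numeral_2_eq_2)
  have D1: "deriv1 \<Gamma> t = D 1 t" for t
    using d0 by (rule vector_derivative_at)
  have D2: "deriv1 (D 1) t = D 2 t" for t
    using d1 by (rule vector_derivative_at)
  have null: "herm (\<Gamma> t) (\<Gamma> t) = 0" and proj: "\<gamma> t = proj (\<Gamma> t)" for t
    using lift by (auto simp: is_lift_def null_vectors_def)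
  \<comment> \<open>A zero product is impossible: \<open>inverse 0 = 0\<close> would turn the left
    side of \<open>nat\<close> into 0.\<close>
  have natural: "herm (\<Gamma> t) (D 1 t) = \<i>" for t
    using nat[of t] unfolding D1 by (simp add: field_simps split: if_splits)
  have bend: "Re (herm (D 1 t) (D 1 t)) = 2 * \<kappa>" for t
    using \<Gamma>(2)[of t] by (simp add: bending_def D1)
  have twist: "Im (herm (D 2 t) (D 1 t)) = \<tau> - 3 * \<kappa>\<^sup>2" for t
    using \<Gamma>(3)[of t] unfolding twist_def \<Gamma>(2) D1 D2 by simp
  note det' = det[unfolded D1 D2]
  note ode = isoparametric_ode[OF d0 d1 d2 null natural det' bend twist]
  show ?thesis
    using proj d0 d1 d2[unfolded ode] det' by blast
qed

section \<open>Common phases and rational ratios\<close>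

text \<open>Equal phases make \<open>(y - x) * T\<close> and \<open>(y - z) * T\<close> integer
  multiples of \<open>2 * pi\<close>, so their quotient \<open>q\<close> is rational. As the roots
  sum to zero, \<open>x / z\<close> is a rational function of \<open>q\<close>.\<close>

lemma common_phase_imp_rational_ratio:
  fixes x y z T :: real
  assumes "x < y" "y < z" "x + y + z = 0" "T \<noteq> 0"
    and "exp (- \<i> * of_real x * of_real T) = exp (- \<i> * of_real y * of_real T)"
    and "exp (- \<i> * of_real z * of_real T) = exp (- \<i> * of_real y * of_real T)"
  shows "x / z \<in> \<rat>"
proof -
  obtain m n :: int where
    "- \<i> * of_real x * of_real T = - \<i> * of_real y * of_real T + of_int (2 * m) * pi * \<i>"
    "- \<i> * of_real z * of_real T = - \<i> * of_real y * of_real T + of_int (2 * n) * pi * \<i>"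
    using assms(5,6) unfolding exp_eq by blast
  then have m: "(y - x) * T = 2 * pi * m" and n: "(y - z) * T = 2 * pi * n"
    by (simp_all add: complex_eq_iff algebra_simps)
  define q :: real where "q = m / n"
  have "n \<noteq> 0"
    using n assms by auto
  then have "(y - x) * T = q * ((y - z) * T)"
    unfolding m n by (simp add: q_def)
  then have q: "y - x = q * (y - z)"
    using assms(4) by simp
  have y: "y = - x - z" and z: "z > 0"
    using assms by auto
  have e: "x * (q - 2) = z * (1 - 2 * q)"
    using q unfolding y by (simp add: algebra_simps)
  \<comment> \<open>For \<open>q = 2\<close> the equation \<open>e\<close> would read
    \<open>0 = - 3 * z\<close>.\<close>
  have "q \<noteq> 2"
    using e z by auto
  then have "x / z = (1 - 2 * q) / (q - 2)"
    using e z by (simp add: field_simps)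
  also have "\<dots> \<in> \<rat>"
    by (simp add: q_def)
  finally show ?thesis .
qed

lemma rational_ratio_imp_common_period:
  fixes x y z :: real
  assumes "x + y + z = 0" "z > 0" "x / z \<in> \<rat>"
  obtains T where "T > 0" "exp (- \<i> * of_real x * of_real T) = 1"
    "exp (- \<i> * of_real y * of_real T) = 1" "exp (- \<i> * of_real z * of_real T) = 1"
proof -
  obtain p q :: int where q: "q > 0" and pq: "x / z = p / q"
    using assms(3) by (elim Rats_cases') auto
  \<comment> \<open>Clears the denominator of \<open>x / z\<close>: both \<open>x * T\<close> and
    \<open>z * T\<close> become integer multiples of \<open>2 * pi\<close>, and \<open>y * T\<close>
    follows from the zero sum.\<close>
  define T where "T = 2 * pi * q / z"
  have zT: "z * T = 2 * pi * q" and xT: "x * T = 2 * pi * p"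
    using assms(2) q pq by (auto simp: T_def field_simps)
  have yT: "y * T = 2 * pi * of_int (- p - q)"
    using zT xT assms(1) by (simp add: algebra_simps) algebra
  have phase: "exp (- \<i> * of_real e * of_real T) = 1" if "e * T = 2 * pi * of_int n" for e n
  proof -
    have "- \<i> * of_real e * of_real T = - \<i> * of_real (e * T)" by simp
    also have "\<dots> = \<i> * (of_int (- n) * (of_real pi * 2))"
      unfolding that by simp
    finally show ?thesis
      by (simp only: exp_2pi_1_int)
  qed
  have "T > 0"
    using assms(2) q by (simp add: T_def)
  from that[OF this phase[OF xT] phase[OF yT] phase[OF zT]] show ?thesis .
qed

section \<open>Periodicity and the spectral ratio\<close>

theorem proposition4p3:
  fixes \<gamma> :: "real \<Rightarrow> (complex^3) set" and \<kappa> \<tau> :: real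
  assumes "isoparametric \<gamma> \<kappa> \<tau>"
    and "discriminant_D \<kappa> \<tau> > 0"
  shows "periodic_curve \<gamma> \<longleftrightarrow> spectral_ratio \<kappa> \<tau> \<in> \<rat>"
proof -
  define p q where "p = \<tau> - 3 * \<kappa>\<^sup>2" and "q = 1 - 2 * \<kappa> * \<tau> - 2 * \<kappa> ^ 3"
  have "- 4 * p ^ 3 - 27 * q\<^sup>2 = discriminant_D \<kappa> \<tau>"
    unfolding p_def q_def discriminant_D_def by algebra
  then have "- 4 * p ^ 3 - 27 * q\<^sup>2 > 0"
    using assms(2) by simp
  then obtain x y z where xyz: "x < y" "y < z" "x + y + z = 0"
    and roots: "{t. t ^ 3 + p * t + q = 0} = {x, y, z}"
    by (rule depressed_cubic_roots)
  have "real_eigenvalues (hamiltonian \<kappa> \<tau>) = {x, y, z}"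
    unfolding real_eigenvalues_hamiltonian roots[symmetric] p_def q_def by simp
  then have ratio: "spectral_ratio \<kappa> \<tau> = x / z"
    using xyz by (simp add: spectral_ratio_def)
  from isoparametric_frame[OF assms(1), folded p_def q_def]
  obtain \<Gamma> \<Gamma>1 \<Gamma>2 where
    proj: "\<And>t. \<gamma> t = proj (\<Gamma> t)"
    and d0: "\<And>t. (\<Gamma> has_vector_derivative \<Gamma>1 t) (at t)"
    and d1: "\<And>t. (\<Gamma>1 has_vector_derivative \<Gamma>2 t) (at t)"
    and d2: "\<And>t. (\<Gamma>2 has_vector_derivative of_real p *s \<Gamma>1 t + (- \<i> * of_real q) *s \<Gamma> t) (at t)"
    and det: "\<And>t. det3 (\<Gamma> t) (\<Gamma>1 t) (\<Gamma>2 t) = -1"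
    by blast
  \<comment> \<open>The factor \<open>- \<i>\<close> turns the eigenvalues into the roots of
    \<open>X ^ 3 = p * X - \<i> * q\<close>, the characteristic equation of the lift.\<close>
  define l where "l e = - \<i> * complex_of_real e" for e
  have root: "l e ^ 3 = of_real p * l e + (- \<i> * of_real q)" if "e \<in> {x, y, z}" for e
  proof -
    have "e ^ 3 + p * e + q = 0"
      using that roots by blast
    then have "complex_of_real (e ^ 3 + p * e + q) = 0"
      by (metis of_real_0)
    then have "of_real e ^ 3 + of_real p * of_real e + complex_of_real q = 0"
      by simp
    moreover have "\<i> * \<i> = -1" by simp
    ultimately show ?thesis
      unfolding l_def by algebra
  qed
  \<comment> \<open>Initial values of the quadratic factors in \<open>cubic_ode_solution\<close>,
    collected into vectors; \<open>V\<close> is the Vandermonde product, kept as a factor to avoid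
    division.\<close>
  define u where "u e = \<Gamma>2 0 + l e *s \<Gamma>1 0 + ((l e)\<^sup>2 - of_real p) *s \<Gamma> 0" for e
  define V where "V = (l x - l y) * (l x - l z) * (l y - l z)"
  have ne: "l x \<noteq> l y" "l x \<noteq> l z" "l y \<noteq> l z"
    using xyz by (simp_all add: l_def)
  then have V: "V \<noteq> 0"
    by (simp add: V_def)
  have sol: "V *s \<Gamma> t = ((l y - l z) * exp (l x * of_real t)) *s u x
      + ((l z - l x) * exp (l y * of_real t)) *s u y
      + ((l x - l y) * exp (l z * of_real t)) *s u z" for t
  proof -
    have nth: "((\<lambda>t. f t $ k) has_vector_derivative f' $ k) (at t)"
      if "(f has_vector_derivative f') (at t)" for f :: "real \<Rightarrow> complex^3" and f' k t
      using that by (rule bounded_linear.has_vector_derivative[OF bounded_linear_vec_nth])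
    have nth_d2: "((\<lambda>t. \<Gamma>2 t $ k) has_vector_derivative
        of_real p * \<Gamma>1 t $ k + (- \<i> * of_real q) * \<Gamma> t $ k) (at t)" for k t
      using nth[OF d2[of t], of k] by simp
    have "V * \<Gamma> t $ k = (l y - l z) * exp (l x * of_real t) * u x $ k
      + (l z - l x) * exp (l y * of_real t) * u y $ k
      + (l x - l y) * exp (l z * of_real t) * u z $ k" for k
      using cubic_ode_solution[OF nth[OF d0] nth[OF d1] nth_d2 root root root, of x y z t k]
      by (simp add: V_def u_def algebra_simps)
    then show ?thesis
      by (simp add: vec_eq_iff)
  qed
  show ?thesis
    unfolding ratio
  proof
    assume "periodic_curve \<gamma>"
    then obtain T where T: "T > 0" "\<gamma> (0 + T) = \<gamma> 0"
      unfolding periodic_curve_def by blast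
    then obtain c where c: "\<Gamma> T = c *s \<Gamma> 0"
      using proj proj_eq_imp_multiple by (metis add_0)
    define a1 a2 a3 where "a1 = (l y - l z) * (exp (l x * of_real T) - c)"
      and "a2 = (l z - l x) * (exp (l y * of_real T) - c)"
      and "a3 = (l x - l y) * (exp (l z * of_real T) - c)"
    have "V *s \<Gamma> T - c *s (V *s \<Gamma> 0) = a1 *s u x + a2 *s u y + a3 *s u z"
      unfolding sol a1_def a2_def a3_def by (simp add: vec_eq_iff algebra_simps)
    then have "a1 *s u x + a2 *s u y + a3 *s u z = 0"
      by (simp add: c vec_eq_iff)
    \<comment> \<open>Regrouping along the frame at 0, which is independent, yields three scalar
      equations for the \<open>a\<close>s.\<close>
    then have "(a1 * ((l x)\<^sup>2 - of_real p) + a2 * ((l y)\<^sup>2 - of_real p) + a3 * ((l z)\<^sup>2 - of_real p)) *s \<Gamma> 0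
        + (a1 * l x + a2 * l y + a3 * l z) *s \<Gamma>1 0 + (a1 + a2 + a3) *s \<Gamma>2 0 = 0"
      by (simp add: u_def vec_eq_iff algebra_simps)
    moreover have "det3 (\<Gamma> 0) (\<Gamma>1 0) (\<Gamma>2 0) \<noteq> 0"
      by (simp add: det)
    ultimately have
      s2: "a1 * ((l x)\<^sup>2 - of_real p) + a2 * ((l y)\<^sup>2 - of_real p) + a3 * ((l z)\<^sup>2 - of_real p) = 0"
      and s1: "a1 * l x + a2 * l y + a3 * l z = 0" and s0: "a1 + a2 + a3 = 0"
      by (metis det3_independent)+
    \<comment> \<open>The equations say that the weighted sum of any polynomial of degree at most 2
      over the \<open>l\<close>s is zero; a quadratic vanishing at two of them isolates one
      weight.\<close>
    have "a1 * ((l x - l y) * (l x - l z)) = 0" "a2 * ((l y - l x) * (l y - l z)) = 0"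
      "a3 * ((l z - l x) * (l z - l y)) = 0"
      using s0 s1 s2 by algebra+
    then have "exp (l x * of_real T) = c" "exp (l y * of_real T) = c" "exp (l z * of_real T) = c"
      using ne by (auto simp: a1_def a2_def a3_def)
    then show "x / z \<in> \<rat>"
      using common_phase_imp_rational_ratio[OF xyz, of T] T(1) by (simp add: l_def)
  next
    assume "x / z \<in> \<rat>"
    moreover have "z > 0"
      using xyz by simp
    ultimately obtain T where T: "T > 0" "exp (l x * of_real T) = 1"
      "exp (l y * of_real T) = 1" "exp (l z * of_real T) = 1"
      unfolding l_def using rational_ratio_imp_common_period[OF xyz(3)] by blast
    \<comment> \<open>All phases equal 1, so the lift itself closes up, not only its
      projection.\<close>
    have "V *s \<Gamma> (t + T) = V *s \<Gamma> t" for t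
      unfolding sol using T by (simp add: exp_add distrib_left)
    then have "\<Gamma> (t + T) = \<Gamma> t" for t
      using V by (simp add: vec_eq_iff)
    then show "periodic_curve \<gamma>"
      unfolding periodic_curve_def using T(1) proj by auto
  qed
qed

end
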